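(* Let $X$ be a standard Markov process in $\mathbb{R}^d$, let $C\subseteq\mathbb{R}^d$ be the (open) continuation set, $D=\mathbb{R}^d\setminus C$ the (closed) stopping set, and $D^\circ$ the interior of $D$. If $x\in\partial C$ is probabilistically regular for $D^\circ$ and $X$ can be realised as a stochastic flow $(X_t^y)_{t\ge0,\,y\in\mathbb{R}^d}$ such that, for each given $t\ge0$, the map $y\mapsto X_t^y$ is continuous on $\mathbb{R}^d$ almost surely, then $x$ is Green regular for $D^\circ$ (and thus for $D$ too).
   Context: $X$ is a standard Markov process in the sense of Blumenthal--Getoor (strong Markov, right-continuous with left limits, left-continuous over stopping times), started at $x$ under $\mathsf P_x$, adapted to a right-continuous filtration. $C=\{V>G\}$ and $D=\{V=G\}$ are the continuation and stopping sets of an optimal stopping problem with value function $V$ and gain function $G$; all that matters here is that $C$ is open and $D=\mathbb{R}^d\setminus C$ is closed. For a measurable set $A$: $\tau_A=\inf\{t\ge0:X_t\in A\}$ and $\sigma_A=\inf\{t>0:X_t\in A\}$. $z\in\partial C$ is probabilistically regular for $A$ if $\mathsf P_z(\sigma_A=0)=1$, and Green regular for $A$ if $\lim_{C\ni x\to z}\mathsf P_x(\tau_A\ge\varepsilon)=0$ for each $\varepsilon>0$. $X$ is realised as a stochastic flow if there are processes $X^y=(X_t^y)_{t\ge0}$, $y\in\mathbb{R}^d$, on one probability space $(\Omega,\mathcal F,\mathsf P)$ with right-continuous sample paths and $\mathrm{Law}(X^y\mid\mathsf P)=\mathrm{Law}(X\mid\mathsf P_y)$ for all $y$. *)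

theory Defs
  imports "HOL-Probability.Probability"
begin

text \<open>
  Standard Markov processes (Blumenthal and Getoor) with values in \<open>real ^ 'd\<close> and infinite
  lifetime. Time is real and only times \<open>t \<ge> 0\<close> matter. The filtration is indexed by \<open>ennreal\<close>,
  so that stopping times may be infinite; \<open>F \<infinity>\<close> is the \<open>\<sigma>\<close>-algebra on which the laws
  \<open>P x\<close> live. Where \<open>enn2real (T \<omega>)\<close> is used, \<open>T \<omega> < \<infinity>\<close> is required.

  Completeness of the filtration and shift operators on \<open>\<Omega>\<close> are not required, so the
  definition is slightly more permissive than that of Blumenthal and Getoor.
\<close>

locale standard_process = filtration \<Omega> F
  for \<Omega> :: "'w set" and F :: "ennreal \<Rightarrow> 'w measure" +
  fixes P :: "real ^ 'd \<Rightarrow> 'w measure"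
    and X :: "real \<Rightarrow> 'w \<Rightarrow> real ^ 'd"
  assumes prob_space_P: "\<And>x. prob_space (P x)"
    and sets_P: "\<And>x. sets (P x) = sets (F \<infinity>)"
    and right_continuous_filtration:
      "\<And>t. 0 \<le> t \<Longrightarrow> sets (F (ennreal t)) = (\<Inter>s\<in>{t<..}. sets (F (ennreal s)))"
    and adapted: "\<And>t. 0 \<le> t \<Longrightarrow> X t \<in> borel_measurable (F (ennreal t))"
    and measurable_transition:
      "\<And>t B. 0 \<le> t \<Longrightarrow> B \<in> sets borel \<Longrightarrow>
        (\<lambda>x. measure (P x) {\<omega> \<in> space (P x). X t \<omega> \<in> B}) \<in> borel_measurable borel"
    and starts_at: "\<And>x. AE \<omega> in P x. X 0 \<omega> = x"
    and right_continuous_paths: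
      "\<And>x. AE \<omega> in P x. \<forall>t\<ge>0. continuous (at_right t) (\<lambda>s. X s \<omega>)"
    and left_limits:
      "\<And>x. AE \<omega> in P x. \<forall>t>0. \<exists>l. ((\<lambda>s. X s \<omega>) \<longlongrightarrow> l) (at_left t)"
    and measurable_at_stopping_time:
      "\<And>T. stopping_time F T \<Longrightarrow>
        (\<lambda>\<omega>. X (enn2real (T \<omega>)) \<omega>)
          \<in> borel_measurable (restrict_space (pre_sigma T) {\<omega>. T \<omega> < \<infinity>})"
    and strong_Markov:
      "\<And>T t f x. stopping_time F T \<Longrightarrow> 0 \<le> t \<Longrightarrow>
        f \<in> borel_measurable borel \<Longrightarrow> bounded (range f) \<Longrightarrow>
        AE \<omega> in P x. T \<omega> < \<infinity> \<longrightarrow>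
          real_cond_exp (P x) (pre_sigma T)
            (\<lambda>\<omega>'. f (X (enn2real (T \<omega>') + t) \<omega>') * indicator {\<omega>'. T \<omega>' < \<infinity>} \<omega>') \<omega>
          = (\<integral>\<omega>'. f (X t \<omega>') \<partial>P (X (enn2real (T \<omega>)) \<omega>))"
    and left_continuous_over_stopping_times:
      "\<And>T x. (\<And>n. stopping_time F (T n)) \<Longrightarrow>
        (\<And>\<omega>. \<omega> \<in> \<Omega> \<Longrightarrow> incseq (\<lambda>n. T n \<omega>)) \<Longrightarrow>
        AE \<omega> in P x. (SUP n. T n \<omega>) < \<infinity> \<longrightarrow>
          (\<lambda>n. X (enn2real (T n \<omega>)) \<omega>) \<longlonglongrightarrow> X (enn2real (SUP n. T n \<omega>)) \<omega>"

text \<open>The infimum of the empty set is \<open>\<infinity>\<close>.\<close>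

definition entry_time :: "(real \<Rightarrow> 'w \<Rightarrow> 'a) \<Rightarrow> 'a set \<Rightarrow> 'w \<Rightarrow> ennreal" where
  "entry_time X A \<omega> = Inf {ennreal t | t. 0 \<le> t \<and> X t \<omega> \<in> A}"

definition hitting_time :: "(real \<Rightarrow> 'w \<Rightarrow> 'a) \<Rightarrow> 'a set \<Rightarrow> 'w \<Rightarrow> ennreal" where
  "hitting_time X A \<omega> = Inf {ennreal t | t. 0 < t \<and> X t \<omega> \<in> A}"

text \<open>
  Probabilities of events about entry and hitting times are taken in the completion of \<open>P z\<close>:
  for general Borel sets \<open>A\<close> (already for closed ones) such events are measurable only
  up to null sets, and \<open>measure\<close> is 0 outside the \<open>\<sigma>\<close>-algebra.
\<close>

definition probabilistically_regular ::
  "(real ^ 'd \<Rightarrow> 'w measure) \<Rightarrow> (real \<Rightarrow> 'w \<Rightarrow> real ^ 'd) \<Rightarrow> (real ^ 'd) set \<Rightarrow> real ^ 'd \<Rightarrow> bool"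
where
  "probabilistically_regular P X A z \<longleftrightarrow>
    measure (completion (P z)) {\<omega> \<in> space (P z). hitting_time X A \<omega> = 0} = 1"

definition green_regular ::
  "(real ^ 'd \<Rightarrow> 'w measure) \<Rightarrow> (real \<Rightarrow> 'w \<Rightarrow> real ^ 'd) \<Rightarrow> (real ^ 'd) set \<Rightarrow>
    (real ^ 'd) set \<Rightarrow> real ^ 'd \<Rightarrow> bool"
where
  "green_regular P X C A z \<longleftrightarrow>
    (\<forall>\<epsilon>>0. ((\<lambda>x. measure (completion (P x)) {\<omega> \<in> space (P x). entry_time X A \<omega> \<ge> ennreal \<epsilon>})
      \<longlongrightarrow> 0) (at z within C))"

text \<open>The law of a process is its distribution on the product \<open>\<sigma>\<close>-algebra of path space.\<close>

definition process_law ::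
  "'w measure \<Rightarrow> (real \<Rightarrow> 'w \<Rightarrow> real ^ 'd) \<Rightarrow> (real \<Rightarrow> real ^ 'd) measure" where
  "process_law M X = distr M (\<Pi>\<^sub>M t\<in>{0..}. borel) (\<lambda>\<omega>. \<lambda>t\<in>{0..}. X t \<omega>)"

definition flow_realisation ::
  "(real ^ 'd \<Rightarrow> 'w measure) \<Rightarrow> (real \<Rightarrow> 'w \<Rightarrow> real ^ 'd) \<Rightarrow>
    'v measure \<Rightarrow> (real ^ 'd \<Rightarrow> real \<Rightarrow> 'v \<Rightarrow> real ^ 'd) \<Rightarrow> bool"
where
  "flow_realisation P X Q Y \<longleftrightarrow>
    prob_space Q \<and>
    (\<forall>y. \<forall>t\<ge>0. Y y t \<in> borel_measurable Q) \<and>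
    (\<forall>y. \<forall>\<omega>\<in>space Q. \<forall>t\<ge>0. continuous (at_right t) (\<lambda>s. Y y s \<omega>)) \<and>
    (\<forall>y. process_law Q (Y y) = process_law (P y) X)"

end

theory Submission
  imports Defs
begin

text \<open>
  Let \<open>U\<close> be open and let \<open>S\<close> be the set of rationals in \<open>(0, \<epsilon>)\<close>. By right-continuity of paths,
  regularity of \<open>x\<close> for \<open>U\<close> says that, almost surely under \<open>P x\<close>, the process visits \<open>U\<close> at some
  time in \<open>S\<close>. As \<open>S\<close> is countable, this passes to \<open>Y x\<close> on the flow space, where almost surely
  \<open>y \<mapsto> Y y q\<close> is continuous for all \<open>q \<in> S\<close> at once. Hence, if \<open>Y x\<close> visits \<open>U\<close> at time \<open>q \<in> S\<close>,
  so does \<open>Y y\<close> for \<open>y\<close> near \<open>x\<close>, and by dominated convergence the probability that \<open>Y y\<close> avoids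
  \<open>U\<close> during \<open>S\<close> tends to \<open>0\<close>. It bounds the probability that \<open>X\<close> enters \<open>U\<close> no earlier than \<open>\<epsilon>\<close>.
\<close>

lemma entry_time_less:
  assumes "0 \<le> t" "t < \<epsilon>" "X t \<omega> \<in> A"
  shows "entry_time X A \<omega> < ennreal \<epsilon>"
proof -
  have "entry_time X A \<omega> \<le> ennreal t"
    unfolding entry_time_def by (rule Inf_lower) (use assms in auto)
  also have "\<dots> < ennreal \<epsilon>"
    using assms by (simp add: ennreal_lessI)
  finally show ?thesis .
qed

text \<open>A visit to the open set \<open>U\<close> persists for a short while to the right by
  right-continuity, and that interval contains a rational time still below
  \<open>\<epsilon>\<close>.\<close>

lemma hitting_time_0_imp_rational_visit:
  fixes X :: "real \<Rightarrow> 'w \<Rightarrow> 'a::topological_space"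
  assumes hit: "hitting_time X U \<omega> = 0" and "open U" and "0 < \<epsilon>"
    and cont: "\<forall>t\<ge>0. continuous (at_right t) (\<lambda>s. X s \<omega>)"
  shows "\<exists>q\<in>\<rat> \<inter> {0<..<\<epsilon>}. X q \<omega> \<in> U"
proof -
  have "hitting_time X U \<omega> < ennreal \<epsilon>"
    using hit \<open>0 < \<epsilon>\<close> by simp
  then obtain t where t: "0 < t" "t < \<epsilon>" "X t \<omega> \<in> U"
    unfolding hitting_time_def Inf_less_iff by (auto simp: ennreal_less_iff)
  have "((\<lambda>s. X s \<omega>) \<longlongrightarrow> X t \<omega>) (at_right t)"
    using cont t by (auto simp: continuous_within)
  then have "eventually (\<lambda>s. X s \<omega> \<in> U) (at_right t)"
    using \<open>open U\<close> t by (simp add: topological_tendstoD)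
  moreover have "eventually (\<lambda>s. s < \<epsilon>) (at_right t)"
    using t by (auto simp: eventually_at_right)
  ultimately have "eventually (\<lambda>s. X s \<omega> \<in> U \<and> s < \<epsilon>) (at_right t)"
    by eventually_elim simp
  then obtain b where b: "t < b" "\<And>s. t < s \<Longrightarrow> s < b \<Longrightarrow> X s \<omega> \<in> U \<and> s < \<epsilon>"
    by (auto simp: eventually_at_right[OF t(2)])
  obtain q where "q \<in> \<rat>" "t < q" "q < b"
    using Rats_dense_in_real[OF b(1)] by auto
  then show ?thesis
    using b t by force
qed

lemma avoids_in_sets:
  fixes X :: "real \<Rightarrow> 'w \<Rightarrow> 'a::topological_space"
  assumes "\<And>t. 0 \<le> t \<Longrightarrow> X t \<in> borel_measurable M"
    and "countable S" "S \<subseteq> {0..}" "U \<in> sets borel"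
  shows "{\<omega> \<in> space M. \<forall>q\<in>S. X q \<omega> \<notin> U} \<in> sets M"
proof (rule sets.sets_Collect_countable_All'[OF _ \<open>countable S\<close>])
  fix q assume "q \<in> S"
  then have "X q \<in> borel_measurable M"
    using assms by auto
  from measurable_sets[OF this, of "- U"] assms(4)
  show "{\<omega> \<in> space M. X q \<omega> \<notin> U} \<in> sets M"
    by (simp add: vimage_def Int_def conj_commute)
qed

text \<open>Avoiding \<open>U\<close> at countably many times is an event of the product
  \<sigma>-algebra, so its probability depends on the law alone and carries over between
  \<open>X\<close> and the flow.\<close>

lemma measure_process_law_avoids:
  fixes X :: "real \<Rightarrow> 'w \<Rightarrow> real ^ 'd"
  assumes meas: "\<And>t. 0 \<le> t \<Longrightarrow> X t \<in> borel_measurable M"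
    and S: "countable S" "S \<subseteq> {0..}" and U: "U \<in> sets borel"
  shows "measure (process_law M X)
           {f \<in> space (\<Pi>\<^sub>M t\<in>{0..}. borel). \<forall>q\<in>S. f q \<notin> U}
         = measure M {\<omega> \<in> space M. \<forall>q\<in>S. X q \<omega> \<notin> U}" (is "measure _ ?A = _")
proof -
  have restr: "(\<lambda>\<omega>. \<lambda>t\<in>{0..}. X t \<omega>) \<in> measurable M (\<Pi>\<^sub>M t\<in>{0..}. borel)"
    by (rule measurable_restrict) (use meas in auto)
  have A: "?A \<in> sets (\<Pi>\<^sub>M t\<in>{0..}. borel)"
    using S U by (intro avoids_in_sets[where X = "\<lambda>t f. f t"] measurable_component_singleton) auto
  \<comment> \<open>\<open>S \<subseteq> {0..}\<close> matters here: outside \<open>{0..}\<close>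
    the restricted path is \<open>undefined\<close>.\<close>
  have "(\<lambda>\<omega>. \<lambda>t\<in>{0..}. X t \<omega>) -` ?A \<inter> space M = {\<omega> \<in> space M. \<forall>q\<in>S. X q \<omega> \<notin> U}"
    using measurable_space[OF restr] S(2) by (auto simp: subset_iff)
  then show ?thesis
    unfolding process_law_def by (simp add: measure_distr[OF restr A])
qed

lemma (in prob_space) prob_avoids_tendsto_0:
  fixes Y :: "'b::metric_space \<Rightarrow> real \<Rightarrow> 'a \<Rightarrow> 'c::topological_space"
  assumes meas: "\<And>y t. 0 \<le> t \<Longrightarrow> Y y t \<in> borel_measurable M"
    and cont: "\<And>t. 0 \<le> t \<Longrightarrow> AE \<omega> in M. continuous_on UNIV (\<lambda>y. Y y t \<omega>)"
    and S: "countable S" "S \<subseteq> {0..}" and "open U"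
    and visit: "AE \<omega> in M. \<exists>q\<in>S. Y x q \<omega> \<in> U"
  shows "((\<lambda>y. prob {\<omega> \<in> space M. \<forall>q\<in>S. Y y q \<omega> \<notin> U}) \<longlongrightarrow> 0) (at x within K)"
  unfolding tendsto_at_iff_sequentially
proof (intro allI impI)
  fix y :: "nat \<Rightarrow> 'b" assume y: "y \<longlonglongrightarrow> x"
  let ?B = "\<lambda>z. {\<omega> \<in> space M. \<forall>q\<in>S. Y z q \<omega> \<notin> U}"
  have B [measurable]: "?B z \<in> sets M" for z
    using \<open>open U\<close> by (intro avoids_in_sets meas S) auto
  \<comment> \<open>The null set may depend on the time; countability of \<open>S\<close> merges
    them into one.\<close>
  have "AE \<omega> in M. \<forall>q\<in>S. continuous_on UNIV (\<lambda>z. Y z q \<omega>)"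
    using S cont by (subst AE_ball_countable) auto
  with visit have "AE \<omega> in M. (\<lambda>n. indicat_real (?B (y n)) \<omega>) \<longlonglongrightarrow> 0"
  proof eventually_elim
    case (elim \<omega>)
    then obtain q where q: "q \<in> S" "Y x q \<omega> \<in> U"
      by auto
    with elim have "isCont (\<lambda>z. Y z q \<omega>) x"
      by (simp add: continuous_on_eq_continuous_at)
    then have "(\<lambda>n. Y (y n) q \<omega>) \<longlonglongrightarrow> Y x q \<omega>"
      using y by (rule isCont_tendsto_compose)
    then have "eventually (\<lambda>n. Y (y n) q \<omega> \<in> U) sequentially"
      using \<open>open U\<close> q by (simp add: topological_tendstoD)
    \<comment> \<open>A visit at the single time \<open>q\<close>, which may depend on
      \<open>\<omega>\<close>, already excludes \<open>\<omega>\<close> from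
      \<open>?B (y n)\<close>.\<close>
    then have "eventually (\<lambda>n. indicat_real (?B (y n)) \<omega> = 0) sequentially"
      by eventually_elim (use q in \<open>auto simp: indicator_def\<close>)
    then show ?case
      by (rule tendsto_eventually)
  qed
  then have "(\<lambda>n. \<integral>\<omega>. indicat_real (?B (y n)) \<omega> \<partial>M) \<longlonglongrightarrow> (\<integral>\<omega>. 0 \<partial>M)"
    by (intro integral_dominated_convergence[where w = "\<lambda>_. 1"]) (auto simp: indicator_def)
  then show "((\<lambda>z. prob (?B z)) \<circ> y) \<longlonglongrightarrow> 0"
    by (simp add: comp_def Int_absorb2 Collect_conj_eq)
qed

context standard_process
begin

lemma X_measurable_P: "0 \<le> t \<Longrightarrow> X t \<in> borel_measurable (P y)"
proof -
  assume "0 \<le> t"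
  have "sets (F (ennreal t)) \<subseteq> sets (P y)"
    by (simp add: sets_P sets_F_mono)
  moreover have "space (P y) = space (F (ennreal t))"
    using sets_eq_imp_space_eq[OF sets_P, of y] by (simp add: space_F)
  ultimately show ?thesis
    using adapted[OF \<open>0 \<le> t\<close>] by (auto simp: measurable_def)
qed

text \<open>The target \<open>A\<close> is kept apart from the open set \<open>U\<close> so that one
  proof covers both \<open>interior D\<close> and \<open>D\<close>: a visit to \<open>U\<close> is
  also a visit to \<open>A\<close>.\<close>

lemma green_regular_if_flow:
  assumes reg: "probabilistically_regular P X U x"
    and "open U" "U \<subseteq> A"
    and flow: "flow_realisation P X Q Y"
    and cont: "\<And>t. 0 \<le> t \<Longrightarrow> AE \<omega> in Q. continuous_on UNIV (\<lambda>y. Y y t \<omega>)"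
  shows "green_regular P X C A x"
  unfolding green_regular_def
proof (intro allI impI)
  fix \<epsilon> :: real assume "0 < \<epsilon>"
  \<comment> \<open>The strict upper bound makes a visit during \<open>S\<close> contradict
    \<open>ennreal \<epsilon> \<le> entry_time X A \<omega>\<close>.\<close>
  define S :: "real set" where "S = \<rat> \<inter> {0<..<\<epsilon>}"
  have S: "countable S" "S \<subseteq> {0..}"
    by (auto simp: S_def countable_rat)
  have U: "U \<in> sets borel"
    using \<open>open U\<close> by simp
  interpret Q: prob_space Q
    using flow by (simp add: flow_realisation_def)
  have Y: "Y y t \<in> borel_measurable Q" if "0 \<le> t" for y t
    using flow that by (simp add: flow_realisation_def)
  let ?BX = "\<lambda>y. {\<omega> \<in> space (P y). \<forall>q\<in>S. X q \<omega> \<notin> U}"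
  let ?BY = "\<lambda>y. {\<omega> \<in> space Q. \<forall>q\<in>S. Y y q \<omega> \<notin> U}"
  have BX: "?BX y \<in> sets (P y)" for y
    by (intro avoids_in_sets X_measurable_P S U)
  have BY: "?BY y \<in> sets Q" for y
    by (intro avoids_in_sets Y S U)
  have law: "measure (P y) (?BX y) = measure Q (?BY y)" for y
    using flow measure_process_law_avoids[of X "P y", OF X_measurable_P S U]
      measure_process_law_avoids[of "Y y" Q, OF Y S U]
    by (simp add: flow_realisation_def)

  interpret Px: prob_space "P x" by (rule prob_space_P)
  interpret cPx: prob_space "completion (P x)"
    by (rule Px.prob_space_completion)
  \<comment> \<open>Measure 1 forces the event to be measurable in the completion, as
    \<open>measure\<close> is 0 on other sets; almost-sure statements there then descend to
    \<open>P x\<close>.\<close>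
  have "AE \<omega> in completion (P x). \<omega> \<in> {\<omega> \<in> space (P x). hitting_time X U \<omega> = 0}"
    by (rule cPx.AE_prob_1) (use reg in \<open>simp add: probabilistically_regular_def\<close>)
  then have "AE \<omega> in P x. hitting_time X U \<omega> = 0"
    by (simp add: AE_completion_iff)
  with right_continuous_paths[of x] have "AE \<omega> in P x. \<omega> \<notin> ?BX x"
    by eventually_elim
      (use hitting_time_0_imp_rational_visit[OF _ \<open>open U\<close> \<open>0 < \<epsilon>\<close>] in \<open>auto simp: S_def\<close>)
  then have "measure Q (?BY x) = 0"
    unfolding law[symmetric] using BX by (subst Px.prob_eq_0) auto
  then have "AE \<omega> in Q. \<omega> \<notin> ?BY x"
    using BY by (subst (asm) Q.prob_eq_0) auto
  then have "AE \<omega> in Q. \<exists>q\<in>S. Y x q \<omega> \<in> U"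
    using AE_space by eventually_elim auto
  from Q.prob_avoids_tendsto_0[OF Y cont S \<open>open U\<close> this]
  have lim: "((\<lambda>y. measure Q (?BY y)) \<longlongrightarrow> 0) (at x within C)" .

  have "measure (completion (P y)) {\<omega> \<in> space (P y). ennreal \<epsilon> \<le> entry_time X A \<omega>}
      \<le> measure Q (?BY y)" for y
  proof -
    interpret Py: prob_space "P y" by (rule prob_space_P)
    interpret cPy: prob_space "completion (P y)"
      by (rule Py.prob_space_completion)
    \<comment> \<open>Monotonicity asks for measurability of the larger event only, so none has to
      be shown for the entry-time event.\<close>
    have "measure (completion (P y)) {\<omega> \<in> space (P y). ennreal \<epsilon> \<le> entry_time X A \<omega>}
        \<le> measure (completion (P y)) (?BX y)"
    proof (rule cPy.finite_measure_mono)
      show "{\<omega> \<in> space (P y). ennreal \<epsilon> \<le> entry_time X A \<omega>} \<subseteq> ?BX y"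
      proof safe
        fix \<omega> q assume "ennreal \<epsilon> \<le> entry_time X A \<omega>" "q \<in> S" "X q \<omega> \<in> U"
        then show False
          using entry_time_less[of q \<epsilon> X \<omega> A] \<open>U \<subseteq> A\<close> by (auto simp: S_def)
      qed
    qed (use BX in auto)
    then show ?thesis
      using BX by (simp add: law)
  qed
  then show "((\<lambda>y. measure (completion (P y)) {\<omega> \<in> space (P y). ennreal \<epsilon> \<le> entry_time X A \<omega>})
      \<longlongrightarrow> 0) (at x within C)"
    by (intro tendsto_sandwich[OF _ _ tendsto_const lim]) auto
qed

end

theorem corollary5:
  fixes \<Omega> :: "'w set" and F :: "ennreal \<Rightarrow> 'w measure"
    and P :: "real ^ 'd \<Rightarrow> 'w measure"
    and X :: "real \<Rightarrow> 'w \<Rightarrow> real ^ 'd"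
    and C D :: "(real ^ 'd) set" and x :: "real ^ 'd"
    and Q :: "'v measure"
    and Y :: "real ^ 'd \<Rightarrow> real \<Rightarrow> 'v \<Rightarrow> real ^ 'd"
  assumes "standard_process \<Omega> F P X"
    and "open C" and "D = UNIV - C"
    and "x \<in> frontier C"
    and "probabilistically_regular P X (interior D) x"
    and "flow_realisation P X Q Y"
    and "\<And>t. 0 \<le> t \<Longrightarrow> AE \<omega> in Q. continuous_on UNIV (\<lambda>y. Y y t \<omega>)"
  shows "green_regular P X C (interior D) x \<and> green_regular P X C D x"
proof -
  interpret standard_process \<Omega> F P X by (rule assms(1))
  show ?thesis
    using green_regular_if_flow[OF assms(5) open_interior _ assms(6,7)] interior_subset
    by blast
qed

end
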